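(* Let $\mathcal B$ and $\mathcal C$ be Boolean algebras, with Stone dual spaces $Y$ and $Z$, respectively. Then a continuous function $f: Z \to Y$ is open if and only if the dual Boolean algebra homomorphism $\alpha: \mathcal B \to \mathcal C$ has a lower adjoint.
   Context: The Stone dual space of a Boolean algebra $\mathcal B$ is the set of ultrafilters of $\mathcal B$ with the topology generated by the sets $\widehat b = \{x \mid b \in x\}$, $b \in \mathcal B$; then $b \mapsto \widehat b$ is an isomorphism from $\mathcal B$ onto the Boolean algebra of clopen subsets of the dual space. The homomorphism $\alpha: \mathcal B \to \mathcal C$ dual to a continuous map $f: Z \to Y$ between the dual spaces is the one given by $f^{-1}(\widehat b) = \widehat{\alpha(b)}$ for all $b \in \mathcal B$. A lower adjoint of a map $\alpha: P \to Q$ of posets is a map $\alpha_*: Q \to P$ such that for all $p \in P$ and $q \in Q$: $\alpha_*(q) \le p \iff q \le \alpha(p)$. *)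

theory Defs
  imports "HOL-Analysis.Abstract_Topology"
begin

definition proper_filter :: "'a::boolean_algebra set \<Rightarrow> bool" where
  "proper_filter F \<longleftrightarrow> top \<in> F \<and> bot \<notin> F
     \<and> (\<forall>a\<in>F. \<forall>b\<in>F. inf a b \<in> F) \<and> (\<forall>a\<in>F. \<forall>b. a \<le> b \<longrightarrow> b \<in> F)"

definition ultrafilter :: "'a::boolean_algebra set \<Rightarrow> bool" where
  "ultrafilter x \<longleftrightarrow> proper_filter x \<and> (\<forall>F. proper_filter F \<and> x \<subseteq> F \<longrightarrow> F = x)"

definition stone_hat :: "'a::boolean_algebra \<Rightarrow> 'a set set" where
  "stone_hat b = {x. ultrafilter x \<and> b \<in> x}"

definition stone_space :: "'a::boolean_algebra set topology" where
  "stone_space = topology_generated_by (range stone_hat)"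

definition boolean_hom :: "('a::boolean_algebra \<Rightarrow> 'b::boolean_algebra) \<Rightarrow> bool" where
  "boolean_hom h \<longleftrightarrow> h bot = bot \<and> h top = top
     \<and> (\<forall>a b. h (inf a b) = inf (h a) (h b)) \<and> (\<forall>a b. h (sup a b) = sup (h a) (h b))
     \<and> (\<forall>a. h (- a) = - h a)"

(* The preimage is intersected with the topspace because f is a total function on a type
   that also has elements that are not ultrafilters; its values there are irrelevant. *)
definition is_dual_hom ::
  "('b::boolean_algebra set \<Rightarrow> 'a::boolean_algebra set) \<Rightarrow> ('a \<Rightarrow> 'b) \<Rightarrow> bool" where
  "is_dual_hom f \<alpha> \<longleftrightarrow> boolean_hom \<alpha>
     \<and> (\<forall>b. f -` stone_hat b \<inter> topspace stone_space = stone_hat (\<alpha> b))"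

(* Only meaningful for continuous f; see dual_hom_ex1 and is_dual_hom_dual_hom below. *)
definition dual_hom ::
  "('b::boolean_algebra set \<Rightarrow> 'a::boolean_algebra set) \<Rightarrow> 'a \<Rightarrow> 'b" where
  "dual_hom f = (THE \<alpha>. is_dual_hom f \<alpha>)"

definition lower_adjoint :: "('q::order \<Rightarrow> 'p::order) \<Rightarrow> ('p \<Rightarrow> 'q) \<Rightarrow> bool" where
  "lower_adjoint l \<alpha> \<longleftrightarrow> (\<forall>p q. l q \<le> p \<longleftrightarrow> q \<le> \<alpha> p)"

lemma topspace_stone_space: "topspace stone_space = {x. ultrafilter x}"
proof -
  have "stone_hat top = {x. ultrafilter x}"
    by (auto simp: stone_hat_def ultrafilter_def proper_filter_def)
  then show ?thesis
    by (auto simp: stone_space_def stone_hat_def)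
qed

lemma openin_stone_hat: "openin stone_space (stone_hat b)"
  unfolding stone_space_def by (rule topology_generated_by_Basis) simp

lemma proper_filter_inf: "proper_filter F \<Longrightarrow> a \<in> F \<Longrightarrow> b \<in> F \<Longrightarrow> inf a b \<in> F"
  and proper_filter_mono: "proper_filter F \<Longrightarrow> a \<in> F \<Longrightarrow> a \<le> b \<Longrightarrow> b \<in> F"
  and proper_filter_top: "proper_filter F \<Longrightarrow> top \<in> F"
  and proper_filter_bot: "proper_filter F \<Longrightarrow> bot \<notin> F"
  unfolding proper_filter_def by blast+

lemma ultrafilter_extend:
  assumes "proper_filter (F::'a::boolean_algebra set)"
  shows "\<exists>x. ultrafilter x \<and> F \<subseteq> x"
proof -
  let ?A = "{G. proper_filter G \<and> F \<subseteq> G}"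
  have "\<exists>M\<in>?A. \<forall>X\<in>?A. M \<subseteq> X \<longrightarrow> X = M"
  proof (rule subset_Zorn_nonempty)
    show "?A \<noteq> {}" using assms by blast
  next
    fix C assume ne: "C \<noteq> {}" and ch: "subset.chain ?A C"
    have sub: "\<And>G. G \<in> C \<Longrightarrow> proper_filter G \<and> F \<subseteq> G"
      using ch by (auto simp: subset.chain_def)
    have lin: "\<And>G H. G \<in> C \<Longrightarrow> H \<in> C \<Longrightarrow> G \<subseteq> H \<or> H \<subseteq> G"
      using ch unfolding subset.chain_def by blast
    have "inf a b \<in> \<Union>C" if ab: "a \<in> \<Union>C" "b \<in> \<Union>C" for a b
    proof -
      obtain G H where GH: "a \<in> G" "G \<in> C" "b \<in> H" "H \<in> C" using ab by blast
      then have "\<exists>K\<in>C. a \<in> K \<and> b \<in> K" using lin[of G H] by blast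
      then show ?thesis using sub proper_filter_inf by blast
    qed
    moreover have "b \<in> \<Union>C" if "a \<in> \<Union>C" "a \<le> b" for a b
      using that sub proper_filter_mono by blast
    moreover have "top \<in> \<Union>C" "bot \<notin> \<Union>C" "F \<subseteq> \<Union>C"
      using ne sub proper_filter_top proper_filter_bot by blast+
    ultimately show "\<Union>C \<in> ?A" unfolding proper_filter_def by blast
  qed
  then obtain x where x: "proper_filter x" "F \<subseteq> x"
    and max: "\<And>G. proper_filter G \<Longrightarrow> F \<subseteq> G \<Longrightarrow> x \<subseteq> G \<Longrightarrow> G = x" by auto
  have "ultrafilter x"
    unfolding ultrafilter_def using x max by (metis order_trans)
  with x show ?thesis by auto
qed

lemma proper_filter_adjoin:
  assumes F: "proper_filter F" and b: "- b \<notin> F"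
  shows "proper_filter {c. \<exists>a\<in>F. inf a b \<le> c}"
  unfolding proper_filter_def
proof (intro conjI ballI allI impI)
  show "top \<in> {c. \<exists>a\<in>F. inf a b \<le> c}" using proper_filter_top[OF F] by auto
  show "bot \<notin> {c. \<exists>a\<in>F. inf a b \<le> c}"
  proof
    assume "bot \<in> {c. \<exists>a\<in>F. inf a b \<le> c}"
    then obtain a where a: "a \<in> F" "inf a b \<le> bot" by blast
    then have "inf a b = bot" by (simp add: bot_unique)
    then have "a \<le> - b" by (simp add: inf_shunt)
    then show False using a b proper_filter_mono[OF F] by blast
  qed
next
  fix c d assume "c \<in> {c. \<exists>a\<in>F. inf a b \<le> c}" "d \<in> {c. \<exists>a\<in>F. inf a b \<le> c}"
  then obtain a a' where a: "a \<in> F" "inf a b \<le> c" "a' \<in> F" "inf a' b \<le> d" by blast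
  have "inf (inf a a') b \<le> inf c d"
  proof (rule inf_greatest)
    show "inf (inf a a') b \<le> c"
      by (rule order_trans[OF inf_mono[OF inf_le1 order_refl] a(2)])
    show "inf (inf a a') b \<le> d"
      by (rule order_trans[OF inf_mono[OF inf_le2 order_refl] a(4)])
  qed
  then show "inf c d \<in> {c. \<exists>a\<in>F. inf a b \<le> c}"
    using a proper_filter_inf[OF F] by blast
next
  fix c d assume "c \<in> {c. \<exists>a\<in>F. inf a b \<le> c}" "c \<le> d"
  then show "d \<in> {c. \<exists>a\<in>F. inf a b \<le> c}" using order_trans by blast
qed

lemma ultrafilter_compl:
  assumes x: "ultrafilter x"
  shows "- b \<in> x \<longleftrightarrow> b \<notin> x"
proof
  have F: "proper_filter x" using x by (simp add: ultrafilter_def)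
  show "b \<notin> x" if "- b \<in> x"
    using that proper_filter_inf[OF F, of "- b" b] proper_filter_bot[OF F] by auto
  show "- b \<in> x" if "b \<notin> x"
  proof (rule ccontr)
    assume "- b \<notin> x"
    let ?G = "{c. \<exists>a\<in>x. inf a b \<le> c}"
    have "proper_filter ?G" by (rule proper_filter_adjoin[OF F \<open>- b \<notin> x\<close>])
    moreover have "x \<subseteq> ?G" by (auto intro: inf_le1)
    ultimately have "?G = x" using x by (simp add: ultrafilter_def)
    moreover have "b \<in> ?G" using proper_filter_top[OF F] by auto
    ultimately show False using that by blast
  qed
qed

lemma stone_hat_bot: "stone_hat bot = {}"
  and stone_hat_top: "stone_hat top = topspace stone_space"
  and stone_hat_inf: "stone_hat (inf a b) = stone_hat a \<inter> stone_hat b"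
  and stone_hat_compl: "stone_hat (- a) = topspace stone_space - stone_hat a"
proof -
  show "stone_hat bot = {}" "stone_hat top = topspace stone_space"
    unfolding topspace_stone_space stone_hat_def ultrafilter_def
    by (blast dest: proper_filter_bot proper_filter_top)+
  show "stone_hat (inf a b) = stone_hat a \<inter> stone_hat b"
  proof -
    have "inf a b \<in> x \<longleftrightarrow> a \<in> x \<and> b \<in> x" if "ultrafilter x" for x
    proof -
      have F: "proper_filter x" using that by (simp add: ultrafilter_def)
      show ?thesis
        using proper_filter_inf[OF F, of a b] proper_filter_mono[OF F _ inf_le1, of a b]
          proper_filter_mono[OF F _ inf_le2, of a b] by blast
    qed
    then show ?thesis unfolding stone_hat_def by blast
  qed
  show "stone_hat (- a) = topspace stone_space - stone_hat a"
    unfolding topspace_stone_space by (auto simp: stone_hat_def ultrafilter_compl)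
qed

lemma stone_hat_sup: "stone_hat (sup a b) = stone_hat a \<union> stone_hat b"
proof -
  have "sup a b = - inf (- a) (- b)" by simp
  also have "stone_hat \<dots> = stone_hat a \<union> stone_hat b"
    unfolding stone_hat_compl stone_hat_inf topspace_stone_space
    by (auto simp: stone_hat_def)
  finally show ?thesis .
qed

lemma stone_hat_subset_iff: "stone_hat a \<subseteq> stone_hat b \<longleftrightarrow> a \<le> b"
proof
  assume sub: "stone_hat a \<subseteq> stone_hat b"
  show "a \<le> b"
  proof (rule ccontr)
    assume "\<not> a \<le> b"
    then have nb: "inf a (- b) \<noteq> bot" by (simp add: inf_shunt)
    have "proper_filter {c. inf a (- b) \<le> c}"
      unfolding proper_filter_def
    proof (intro conjI ballI allI impI)
      show "bot \<notin> {c. inf a (- b) \<le> c}"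
        using nb bot_unique by blast
    next
      fix c d assume "c \<in> {c. inf a (- b) \<le> c}" "c \<le> d"
      then show "d \<in> {c. inf a (- b) \<le> c}" using order_trans by blast
    qed simp_all
    then obtain x where x: "ultrafilter x" "{c. inf a (- b) \<le> c} \<subseteq> x"
      using ultrafilter_extend by blast
    then have "a \<in> x" "- b \<in> x" by auto
    then show False using sub x ultrafilter_compl by (auto simp: stone_hat_def)
  qed
next
  assume "a \<le> b"
  then show "stone_hat a \<subseteq> stone_hat b"
    unfolding stone_hat_def ultrafilter_def by (blast dest: proper_filter_mono)
qed

lemma stone_hat_eq_iff: "stone_hat a = stone_hat b \<longleftrightarrow> a = b"
  by (metis order_antisym order_refl stone_hat_subset_iff)

lemma stone_space_base:
  assumes "openin stone_space U" "x \<in> U"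
  shows "\<exists>a. x \<in> stone_hat a \<and> stone_hat a \<subseteq> U"
proof -
  have "generate_topology_on (range stone_hat) U"
    using assms(1) unfolding stone_space_def by (rule openin_topology_generated_by)
  then show ?thesis using assms(2)
  proof (induction arbitrary: x rule: generate_topology_on.induct)
    case Empty
    then show ?case by simp
  next
    case (Int U V)
    then obtain a b where "x \<in> stone_hat a" "stone_hat a \<subseteq> U" "x \<in> stone_hat b" "stone_hat b \<subseteq> V"
      by (metis IntE)
    then show ?case by (intro exI[of _ "inf a b"]) (auto simp: stone_hat_inf)
  next
    case (UN K)
    then show ?case by (metis UnionE Union_upper order_trans)
  next
    case (Basis s)
    then show ?case by blast
  qed
qed

lemma clopen_stone_hat:
  assumes op: "openin stone_space K" and cl: "closedin stone_space K"
  shows "\<exists>c. K = stone_hat c"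
proof -
  let ?X = "topspace stone_space"
  let ?D = "{a. stone_hat a \<subseteq> K}" and ?E = "{b. stone_hat b \<subseteq> ?X - K}"
  have opc: "openin stone_space (?X - K)" using cl by (simp add: closedin_def)
  have "\<exists>a\<in>?D. \<exists>b\<in>?E. sup a b = top"
  proof (rule ccontr)
    assume no: "\<not> ?thesis"
    let ?F = "{c. \<exists>a\<in>?D. \<exists>b\<in>?E. - sup a b \<le> c}"
    have "inf c d \<in> ?F" if "c \<in> ?F" "d \<in> ?F" for c d
    proof -
      from that obtain a b a' b' where ab: "a \<in> ?D" "b \<in> ?E" "- sup a b \<le> c"
        "a' \<in> ?D" "b' \<in> ?E" "- sup a' b' \<le> d" by blast
      have "- sup (sup a a') (sup b b') = inf (- sup a b) (- sup a' b')"
        by (simp add: inf_aci)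
      also have "\<dots> \<le> inf c d" by (rule inf_mono[OF ab(3,6)])
      finally have "- sup (sup a a') (sup b b') \<le> inf c d" .
      moreover have "sup a a' \<in> ?D" "sup b b' \<in> ?E" using ab by (auto simp: stone_hat_sup)
      ultimately show ?thesis by blast
    qed
    moreover have "d \<in> ?F" if "c \<in> ?F" "c \<le> d" for c d
      using that order_trans by blast
    moreover have "bot \<notin> ?F"
    proof
      assume "bot \<in> ?F"
      then obtain a b where ab: "a \<in> ?D" "b \<in> ?E" "- sup a b \<le> bot" by blast
      then have "- sup a b = bot" by (simp only: bot_unique)
      then have "sup a b = top" by (metis compl_bot_eq double_compl)
      then show False using no ab by blast
    qed
    moreover have bots: "bot \<in> ?D" "bot \<in> ?E" by (simp_all add: stone_hat_bot)
    then have "top \<in> ?F" using top_greatest by blast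
    ultimately have "proper_filter ?F" unfolding proper_filter_def by blast
    then obtain x where x: "ultrafilter x" "?F \<subseteq> x" using ultrafilter_extend by blast
    have not_in: "c \<notin> x" if "c \<in> ?D \<or> c \<in> ?E" for c
    proof -
      have "- c \<in> ?F"
      proof -
        have "- sup c bot \<le> - c" "- sup bot c \<le> - c" by simp_all
        then show ?thesis using that bots by blast
      qed
      then show ?thesis using x ultrafilter_compl by blast
    qed
    show False
    proof (cases "x \<in> K")
      case True
      then obtain c where "x \<in> stone_hat c" "stone_hat c \<subseteq> K"
        using stone_space_base[OF op] by blast
      then show False using not_in[of c] by (auto simp: stone_hat_def)
    next
      case False
      then have "x \<in> ?X - K" using x by (simp add: topspace_stone_space)
      then obtain c where "x \<in> stone_hat c" "stone_hat c \<subseteq> ?X - K"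
        using stone_space_base[OF opc] by blast
      then show False using not_in[of c] by (auto simp: stone_hat_def)
    qed
  qed
  then obtain a b where ab: "stone_hat a \<subseteq> K" "stone_hat b \<subseteq> ?X - K" "sup a b = top" by blast
  then have "?X = stone_hat a \<union> stone_hat b" by (metis stone_hat_sup stone_hat_top)
  moreover have "K \<subseteq> ?X" using op by (rule openin_subset)
  ultimately have "K = stone_hat a" using ab by blast
  then show ?thesis by blast
qed

lemma dual_hom_ex1:
  fixes f :: "'b::boolean_algebra set \<Rightarrow> 'a::boolean_algebra set"
  assumes f: "continuous_map stone_space stone_space f"
  shows "\<exists>!\<alpha>. is_dual_hom f \<alpha>"
proof -
  let ?X = "topspace (stone_space :: 'b set topology)"
  let ?P = "\<lambda>b. f -` stone_hat b \<inter> ?X"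
  have P: "?P b = {x \<in> ?X. f x \<in> stone_hat b}" for b by auto
  have "\<exists>c. ?P b = stone_hat c" for b
  proof (rule clopen_stone_hat)
    show "openin stone_space (?P b)"
      unfolding P by (rule openin_continuous_map_preimage[OF f openin_stone_hat])
    have "closedin stone_space (stone_hat b)"
      using openin_stone_hat[of "- b"] openin_subset[OF openin_stone_hat]
      by (simp add: closedin_def stone_hat_compl)
    then show "closedin stone_space (?P b)"
      unfolding P by (rule closedin_continuous_map_preimage[OF f])
  qed
  then obtain \<alpha> where \<alpha>: "\<And>b. ?P b = stone_hat (\<alpha> b)" by metis
  have fX: "f x \<in> topspace stone_space" if "x \<in> ?X" for x
    using f that by (auto simp: continuous_map_def)
  have eqI: "a = b" if "stone_hat a = stone_hat b" for a b :: 'b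
    using that by (simp add: stone_hat_eq_iff)
  have "boolean_hom \<alpha>"
    unfolding boolean_hom_def
    by (intro conjI allI; rule eqI)
      (use fX in \<open>auto simp: stone_hat_bot stone_hat_top stone_hat_inf stone_hat_sup
        stone_hat_compl \<alpha>[symmetric]\<close>)
  then have ex: "is_dual_hom f \<alpha>" using \<alpha> by (simp add: is_dual_hom_def)
  show ?thesis
  proof (rule ex1I[where a = \<alpha>])
    show "is_dual_hom f \<alpha>" by (rule ex)
  next
    fix \<beta> assume "is_dual_hom f \<beta>"
    then have "stone_hat (\<beta> b) = stone_hat (\<alpha> b)" for b
      by (simp add: is_dual_hom_def \<alpha>)
    then show "\<beta> = \<alpha>" by (auto simp: stone_hat_eq_iff)
  qed
qed

lemma is_dual_hom_dual_hom:
  assumes "continuous_map stone_space stone_space f"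
  shows "is_dual_hom f (dual_hom f)"
  unfolding dual_hom_def by (rule theI'[OF dual_hom_ex1[OF assms]])

end

theory Submission
  imports Defs
begin

text \<open>
  The image of a basic clopen set \<open>stone_hat c\<close> under \<open>f\<close> is the intersection of all \<open>stone_hat b\<close>
  with \<open>c \<le> \<alpha> b\<close>; this is where an ultrafilter has to be constructed. Hence that image is always
  closed, and if \<open>f\<close> is open it is clopen, so equal to \<open>stone_hat (l c)\<close> for some \<open>l c\<close>, and \<open>l\<close> is
  a lower adjoint of \<open>\<alpha>\<close>. Conversely, a lower adjoint \<open>l\<close> turns the intersection into the one over
  all \<open>b \<ge> l c\<close>, which is the open set \<open>stone_hat (l c)\<close>.
\<close>

lemma closedin_stone_hat: "closedin stone_space (stone_hat b)"
  using openin_stone_hat[of "- b"] openin_subset[OF openin_stone_hat]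
  by (simp add: closedin_def stone_hat_compl)

lemma ultrafilter_subset_eq:
  assumes "ultrafilter x" "ultrafilter y" "x \<subseteq> y"
  shows "x = y"
  using assms unfolding ultrafilter_def by blast

text \<open>Pointwise form of duality: reading the defining equation of \<open>\<alpha>\<close> at a
  point \<open>x\<close> shows that \<open>f x\<close> is the preimage of \<open>x\<close> under
  \<open>\<alpha>\<close>. The case \<open>b = top\<close> gives that \<open>f x\<close> is an
  ultrafilter.\<close>

lemma is_dual_hom_mem_iff:
  assumes "is_dual_hom f \<alpha>" "ultrafilter x"
  shows "ultrafilter (f x)" "b \<in> f x \<longleftrightarrow> \<alpha> b \<in> x"
proof -
  have *: "f x \<in> stone_hat b \<longleftrightarrow> x \<in> stone_hat (\<alpha> b)" for b
    using assms by (auto simp: is_dual_hom_def topspace_stone_space)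
  have "\<alpha> top = top"
    using assms(1) by (simp add: is_dual_hom_def boolean_hom_def)
  then show u: "ultrafilter (f x)"
    using *[of top] assms(2) by (simp add: stone_hat_top topspace_stone_space)
  show "b \<in> f x \<longleftrightarrow> \<alpha> b \<in> x"
    using *[of b] u assms(2) by (simp add: stone_hat_def)
qed

text \<open>If the image of \<open>stone_hat c\<close> is known to be
  \<open>stone_hat (l c)\<close>, this equivalence becomes the adjunction between \<open>l\<close>
  and \<open>\<alpha>\<close>.\<close>

lemma is_dual_hom_image_subset_iff:
  assumes "is_dual_hom f \<alpha>"
  shows "f ` stone_hat c \<subseteq> stone_hat b \<longleftrightarrow> c \<le> \<alpha> b"
proof -
  have "f ` stone_hat c \<subseteq> stone_hat b \<longleftrightarrow> stone_hat c \<subseteq> stone_hat (\<alpha> b)"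
    using is_dual_hom_mem_iff[OF assms] unfolding stone_hat_def by blast
  then show ?thesis by (simp add: stone_hat_subset_iff)
qed

lemma is_dual_hom_image_stone_hat:
  fixes f :: "'c::boolean_algebra set \<Rightarrow> 'b::boolean_algebra set"
  assumes d: "is_dual_hom f \<alpha>"
  shows "f ` stone_hat c = (\<Inter>b\<in>{b. c \<le> \<alpha> b}. stone_hat b)"
proof
  show "f ` stone_hat c \<subseteq> (\<Inter>b\<in>{b. c \<le> \<alpha> b}. stone_hat b)"
    using is_dual_hom_image_subset_iff[OF d] by blast
next
  have h: "\<alpha> top = top" "\<alpha> (inf a b) = inf (\<alpha> a) (\<alpha> b)" "\<alpha> (- a) = - \<alpha> a" for a b
    using d by (auto simp: is_dual_hom_def boolean_hom_def)
  show "(\<Inter>b\<in>{b. c \<le> \<alpha> b}. stone_hat b) \<subseteq> f ` stone_hat c"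
  proof
    fix y assume y: "y \<in> (\<Inter>b\<in>{b. c \<le> \<alpha> b}. stone_hat b)"
    have mem: "b \<in> y" if "c \<le> \<alpha> b" for b
      using y that by (auto simp: stone_hat_def)
    have uy: "ultrafilter y"
      using INT_D[OF y, of top] h(1) by (simp add: stone_hat_def)
    then have F: "proper_filter y" by (simp add: ultrafilter_def)
    \<comment> \<open>The filter generated by \<open>c\<close> and the \<open>\<alpha>\<close>-image
      of \<open>y\<close>: an ultrafilter \<open>x\<close> extending it lies in
      \<open>stone_hat c\<close> and satisfies \<open>y \<subseteq> f x\<close>, hence
      \<open>y = f x\<close> by maximality.\<close>
    let ?G = "{e. \<exists>b\<in>y. inf (\<alpha> b) c \<le> e}"
    have "proper_filter ?G"
      unfolding proper_filter_def
    proof (intro conjI ballI allI impI)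
      show "top \<in> ?G" using proper_filter_top[OF F] by auto
      show "bot \<notin> ?G"
      proof
        assume "bot \<in> ?G"
        then obtain b where b: "b \<in> y" "inf c (\<alpha> b) = bot"
          by (auto simp: bot_unique inf_commute)
        \<comment> \<open>So \<open>- b\<close> is an index of the intersection, and
          \<open>y\<close> would contain both \<open>b\<close> and \<open>- b\<close>.\<close>
        then have "c \<le> \<alpha> (- b)" by (simp add: h inf_shunt)
        then show False using mem b(1) ultrafilter_compl[OF uy] by blast
      qed
    next
      fix e e' assume "e \<in> ?G" "e' \<in> ?G"
      then obtain b b' where b: "b \<in> y" "inf (\<alpha> b) c \<le> e" "b' \<in> y" "inf (\<alpha> b') c \<le> e'"
        by blast
      have "inf (\<alpha> (inf b b')) c = inf (inf (\<alpha> b) c) (inf (\<alpha> b') c)"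
        by (simp add: h inf_aci)
      also have "\<dots> \<le> inf e e'" using b by (blast intro: inf_mono)
      finally show "inf e e' \<in> ?G" using b proper_filter_inf[OF F] by blast
    next
      fix e e' assume "e \<in> ?G" "e \<le> e'"
      then show "e' \<in> ?G" using order_trans by blast
    qed
    then obtain x where x: "ultrafilter x" "?G \<subseteq> x" using ultrafilter_extend by blast
    have "c \<in> ?G" using proper_filter_top[OF F] by auto
    then have "x \<in> stone_hat c" using x subsetD[OF x(2)] by (simp add: stone_hat_def)
    moreover have "y \<subseteq> f x"
    proof
      fix b assume "b \<in> y"
      then have "\<alpha> b \<in> ?G" using inf_le1 by blast
      then show "b \<in> f x" using is_dual_hom_mem_iff[OF d x(1)] x(2) by blast
    qed
    then have "y = f x"
      by (rule ultrafilter_subset_eq[OF uy is_dual_hom_mem_iff(1)[OF d x(1)]])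
    ultimately show "y \<in> f ` stone_hat c" by blast
  qed
qed

text \<open>The sets \<open>stone_hat c\<close> form a base, and taking images commutes with
  unions.\<close>

lemma open_map_stone_spaceI:
  fixes f :: "'a::boolean_algebra set \<Rightarrow> 'b"
  assumes "\<And>c. openin X (f ` stone_hat c)"
  shows "open_map stone_space X f"
  unfolding open_map_def
proof (intro allI impI)
  fix U :: "'a set set" assume U: "openin stone_space U"
  show "openin X (f ` U)"
  proof (subst openin_subopen, intro ballI)
    fix y assume "y \<in> f ` U"
    then obtain x where "x \<in> U" "y = f x" by blast
    moreover from stone_space_base[OF U this(1)]
    obtain c where "x \<in> stone_hat c" "stone_hat c \<subseteq> U" by blast
    ultimately show "\<exists>T. openin X T \<and> y \<in> T \<and> T \<subseteq> f ` U"
      using assms[of c] by blast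
  qed
qed

theorem proposition3p4:
  fixes f :: "'c::boolean_algebra set \<Rightarrow> 'b::boolean_algebra set"
  assumes "continuous_map stone_space stone_space f"
  shows "open_map stone_space stone_space f \<longleftrightarrow>
    (\<exists>l :: 'c \<Rightarrow> 'b. lower_adjoint l (dual_hom f))"
proof
  note d = is_dual_hom_dual_hom[OF assms]
  note image = is_dual_hom_image_stone_hat[OF d]
  show "\<exists>l. lower_adjoint l (dual_hom f)" if op: "open_map stone_space stone_space f"
  proof -
    have "\<exists>a. f ` stone_hat c = stone_hat a" for c
    proof (rule clopen_stone_hat)
      show "openin stone_space (f ` stone_hat c)"
        using op openin_stone_hat by (auto simp: open_map_def)
      \<comment> \<open>Makes \<open>top\<close> an index: the intersection over an empty family
        would be \<open>UNIV\<close>, which is not closed.\<close>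
      have "dual_hom f top = top"
        using d by (simp add: is_dual_hom_def boolean_hom_def)
      then have "{b. c \<le> dual_hom f b} \<noteq> {}" by (metis empty_Collect_eq top_greatest)
      then show "closedin stone_space (f ` stone_hat c)"
        unfolding image by (auto intro: closedin_stone_hat)
    qed
    then obtain l where "\<And>c. f ` stone_hat c = stone_hat (l c)" by metis
    then have "lower_adjoint l (dual_hom f)"
      using is_dual_hom_image_subset_iff[OF d]
      by (simp add: lower_adjoint_def stone_hat_subset_iff)
    then show ?thesis by blast
  qed
  show "open_map stone_space stone_space f" if "\<exists>l. lower_adjoint l (dual_hom f)"
  proof -
    from that obtain l where l: "c \<le> dual_hom f b \<longleftrightarrow> l c \<le> b" for c b
      by (auto simp: lower_adjoint_def)
    \<comment> \<open>The indices are now the \<open>b\<close> above \<open>l c\<close>, so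
      \<open>l c\<close> is the least one and its \<open>stone_hat\<close> is the whole
      intersection.\<close>
    have "f ` stone_hat c = stone_hat (l c)" for c
      unfolding image l using stone_hat_subset_iff by blast
    then show ?thesis
      by (simp add: open_map_stone_spaceI openin_stone_hat)
  qed
qed

end
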